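(* For every simplicial complex $\Gamma \subseteq \Delta = 2^{\{1,\ldots,n\}}$, the (canonical) Alexander dual of the Stanley-Reisner ideal $I_\Gamma$ is the Stanley-Reisner ideal of the Alexander dual simplicial complex: $$I_\Gamma^\vee = I_{\Gamma^\vee}.$$
   Context: $k$ is a field, $n\ge 2$, $S=k[x_1,\ldots,x_n]$, $x^{\mathbf a}=x_1^{a_1}\cdots x_n^{a_n}$, and $\preceq$ is the coordinatewise partial order on $\mathbb Z^n$; $\mathbf 1=(1,\ldots,1)$. "Ideal" means proper monomial ideal of $S$. For $\mathbf b\in\mathbb N^n$ put $\mathfrak m^{\mathbf b}=\langle x_i^{b_i}\mid b_i\ge 1\rangle$; these are exactly the irreducible monomial ideals. $\mathbf a_I$ is the exponent vector of the least common multiple of the minimal generators of $I$, and $\mathrm{Irr}(I)$ is the set of irreducible components in the unique irredundant decomposition of $I$ as an intersection of irreducible monomial ideals; $\mathfrak m^{\mathbf b}\in\mathrm{Irr}(I)$ implies $\mathbf b\preceq\mathbf a_I$. For $\mathbf 0\preceq\mathbf b\preceq\mathbf a$ let $\mathbf b^{\mathbf a}$ be the vector with $i$th coordinate $a_i+1-b_i$ if $b_i\ge1$ and $0$ if $b_i=0$. For $\mathbf a\succeq\mathbf a_I$ the Alexander dual ideal of $I$ with respect to $\mathbf a$ is $I^{\mathbf a}=\langle x^{\mathbf b^{\mathbf a}}\mid \mathfrak m^{\mathbf b}\in\mathrm{Irr}(I)\rangle$, and $I^\vee:=I^{\mathbf a_I}$. Faces $F\subseteq\{1,\ldots,n\}$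 are identified with their characteristic vectors in $\{0,1\}^n$, and $\overline F=\{1,\ldots,n\}\setminus F$. For a simplicial complex $\Gamma\subseteq\Delta$, $I_\Gamma=\langle x^F\mid F\notin\Gamma\rangle$ and $\Gamma^\vee=\{F\in\Delta\mid \overline F\notin\Gamma\}$. *)

theory Defs
  imports "HOL-Analysis.Finite_Cartesian_Product" "HOL-Library.Poly_Mapping"
begin

text \<open>
  The variables are indexed by a finite type \<open>'n\<close>. Exponent vectors are elements of
  \<open>nat ^ 'n\<close>, whose library order \<open>\<le>\<close> is the coordinatewise one. The polynomial ring
  is the monoid algebra of exponent vectors: finitely supported maps from exponent vectors to
  coefficients, with convolution as multiplication.
\<close>

type_synonym ('n, 'k) mpoly = "(nat, 'n) vec \<Rightarrow>\<^sub>0 'k"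

definition xpow :: "nat ^ 'n \<Rightarrow> ('n::finite, 'k::field) mpoly"
  where "xpow a = Poly_Mapping.single a 1"


subsection \<open>Ideals of a commutative ring\<close>

lemma module_times: "module ((*) :: 'a \<Rightarrow> 'a \<Rightarrow> 'a::comm_ring_1)"
  by unfold_locales (simp_all add: algebra_simps)

text \<open>Ideals are the submodules of the ring, viewed as a module over itself.\<close>

abbreviation is_ideal :: "'a::comm_ring_1 set \<Rightarrow> bool"
  where "is_ideal \<equiv> module.subspace (*)"

abbreviation ideal_gen :: "'a::comm_ring_1 set \<Rightarrow> 'a set"
  where "ideal_gen \<equiv> module.span (*)"

definition irreducible_ideal :: "'a::comm_ring_1 set \<Rightarrow> bool"
  where "irreducible_ideal Q \<longleftrightarrow> is_ideal Q \<and> Q \<noteq> UNIV \<and>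
    (\<forall>J K. is_ideal J \<and> is_ideal K \<and> Q = J \<inter> K \<longrightarrow> Q = J \<or> Q = K)"


subsection \<open>Monomial ideals and irreducible decompositions\<close>

definition monomial_ideal :: "('n::finite, 'k::field) mpoly set \<Rightarrow> bool"
  where "monomial_ideal I \<longleftrightarrow> (\<exists>A. I = ideal_gen (xpow ` A))"

definition mpower_ideal :: "nat ^ 'n \<Rightarrow> ('n::finite, 'k::field) mpoly set"
  where "mpower_ideal b = ideal_gen {xpow (axis i (b $ i)) | i. b $ i \<ge> 1}"

definition irredundant_irr_decomp ::
    "('n::finite, 'k::field) mpoly set \<Rightarrow> ('n, 'k) mpoly set set \<Rightarrow> bool"
  where "irredundant_irr_decomp I D \<longleftrightarrow>
    finite D \<and> (\<forall>Q\<in>D. monomial_ideal Q \<and> irreducible_ideal Q) \<and>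
    \<Inter>D = I \<and> (\<forall>Q\<in>D. \<Inter>(D - {Q}) \<noteq> I)"

text \<open>
  Every monomial ideal has exactly one irredundant irreducible decomposition. For the unit ideal
  it is the empty one, since \<open>\<Inter>{} = UNIV\<close>.
\<close>

definition Irr :: "('n::finite, 'k::field) mpoly set \<Rightarrow> ('n, 'k) mpoly set set"
  where "Irr I = (THE D. irredundant_irr_decomp I D)"


subsection \<open>Alexander dual ideals\<close>

text \<open>
  The minimal generators of a monomial ideal are the monomials in it that are minimal under
  divisibility, which on exponents is the coordinatewise order.
\<close>

definition min_gen_exps :: "('n::finite, 'k::field) mpoly set \<Rightarrow> (nat ^ 'n) set"
  where "min_gen_exps I = {a. xpow a \<in> I \<and> (\<forall>b. xpow b \<in> I \<and> b \<le> a \<longrightarrow> b = a)}"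

text \<open>
  An exponent vector of a least common multiple is a coordinatewise maximum. There are only
  finitely many minimal generators; if there are none (the zero ideal), the lcm is \<open>1\<close>,
  in accordance with \<open>Sup {} = 0\<close> on the natural numbers.
\<close>

definition lcm_exp :: "('n::finite, 'k::field) mpoly set \<Rightarrow> nat ^ 'n"
  where "lcm_exp I = (\<chi> i. SUP a\<in>min_gen_exps I. a $ i)"

text \<open>
  The next two definitions are meant for \<open>b \<le> a\<close> and \<open>lcm_exp I \<le> a\<close>,
  respectively; then the subtraction below is not truncated.
\<close>

definition dual_exp :: "nat ^ 'n \<Rightarrow> nat ^ 'n \<Rightarrow> nat ^ 'n::finite"
  where "dual_exp a b = (\<chi> i. if b $ i \<ge> 1 then a $ i + 1 - b $ i else 0)"

definition alexander_dual ::
    "nat ^ 'n \<Rightarrow> ('n::finite, 'k::field) mpoly set \<Rightarrow> ('n, 'k) mpoly set"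
  where "alexander_dual a I = ideal_gen {xpow (dual_exp a b) | b. mpower_ideal b \<in> Irr I}"

definition canonical_alexander_dual ::
    "('n::finite, 'k::field) mpoly set \<Rightarrow> ('n, 'k) mpoly set"
  where "canonical_alexander_dual I = alexander_dual (lcm_exp I) I"


subsection \<open>Simplicial complexes\<close>

text \<open>
  Simplicial complexes on the vertex set \<open>UNIV :: 'n set\<close>. The void complex \<open>{}\<close> is allowed
  (it is the Alexander dual of the full simplex), and not every vertex has to be a face.
\<close>

definition simplicial_cplx :: "'n set set \<Rightarrow> bool"
  where "simplicial_cplx \<Gamma> \<longleftrightarrow> (\<forall>F\<in>\<Gamma>. \<forall>G. G \<subseteq> F \<longrightarrow> G \<in> \<Gamma>)"

definition char_vec :: "'n set \<Rightarrow> nat ^ 'n::finite"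
  where "char_vec F = (\<chi> i. of_bool (i \<in> F))"

definition stanley_reisner_ideal :: "'n set set \<Rightarrow> ('n::finite, 'k::field) mpoly set"
  where "stanley_reisner_ideal \<Gamma> = ideal_gen {xpow (char_vec F) | F. F \<notin> \<Gamma>}"

definition dual_cplx :: "'n set set \<Rightarrow> 'n set set"
  where "dual_cplx \<Gamma> = {F. - F \<notin> \<Gamma>}"

end

theory Submission
  imports Defs
begin

text \<open>
  A monomial ideal is the set of all polynomials whose exponents lie in some up-closed set of
  exponent vectors (\<open>ideal_gen_monomials\<close>), so that sums and intersections of monomial
  ideals become unions and intersections of up-closed sets. The exponents of the Stanley-Reisner
  ideal of \<open>\<Gamma>\<close> are those whose support is not a face. A set fails to be a face exactly when it
  lies in no facet, so this ideal is the intersection of the ideals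
  \<open>\<langle>x\<^sub>i | i \<notin> F\<rangle>\<close> over the facets \<open>F\<close>; the void complex has no facets and
  gives the unit ideal.

  This intersection is the irredundant irreducible decomposition. Its components are prime
  (\<open>squarefree_mpower_ideal_prime\<close>), hence irreducible, and none can be omitted because
  facets are not contained in each other. It is the only such decomposition: the lattice of
  monomial ideals is distributive, so an irreducible monomial ideal that contains a finite
  intersection of monomial ideals contains one of them
  (\<open>irreducible_contains_component\<close>), and two irredundant decompositions must then have
  the same members.

  The lcm of the minimal generators has exponent 1 at each vertex \<open>i\<close> outside a facet \<open>F\<close>, as a
  minimal nonface inside \<open>F \<union> {i}\<close> contains \<open>i\<close>. Dualizing therefore sends the
  characteristic vector of the complement of \<open>F\<close> to itself. The dual ideal is generated by the
  monomials of complements of facets, and the complements of faces are the nonfaces of the dual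
  complex.
\<close>


section \<open>Monomial ideals as up-closed sets of exponents\<close>

definition supported_in :: "(nat ^ 'n::finite) set \<Rightarrow> ('n, 'k::field) mpoly set"
  where "supported_in U = {f. Poly_Mapping.keys f \<subseteq> U}"

definition up_closed :: "'a::order set \<Rightarrow> bool"
  where "up_closed U \<longleftrightarrow> (\<forall>a\<in>U. \<forall>b. a \<le> b \<longrightarrow> b \<in> U)"

lemma up_closedD: "up_closed U \<Longrightarrow> a \<in> U \<Longrightarrow> a \<le> b \<Longrightarrow> b \<in> U"
  by (auto simp: up_closed_def)

lemma up_closed_generated: "up_closed {a. \<exists>b\<in>A. b \<le> a}"
  unfolding up_closed_def by (blast dest: order_trans)

lemma xpow_in_supported_in [simp]:
  "(xpow a :: ('n::finite, 'k::field) mpoly) \<in> supported_in U \<longleftrightarrow> a \<in> U"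
  by (simp add: supported_in_def xpow_def)

lemma supported_in_Int: "supported_in U \<inter> supported_in V = supported_in (U \<inter> V)"
  by (auto simp: supported_in_def)

lemma supported_in_subset_iff:
  "(supported_in U :: ('n::finite, 'k::field) mpoly set) \<subseteq> supported_in V \<longleftrightarrow> U \<subseteq> V"
proof
  assume sub: "(supported_in U :: ('n, 'k) mpoly set) \<subseteq> supported_in V"
  show "U \<subseteq> V"
  proof
    fix a assume "a \<in> U"
    then have "(xpow a :: ('n, 'k) mpoly) \<in> supported_in U" by simp
    with sub have "(xpow a :: ('n, 'k) mpoly) \<in> supported_in V" by blast
    then show "a \<in> V" by simp
  qed
qed (auto simp: supported_in_def)

lemma supported_in_eq_iff:
  "(supported_in U :: ('n::finite, 'k::field) mpoly set) = supported_in V \<longleftrightarrow> U = V"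
  by (simp only: set_eq_subset supported_in_subset_iff)

lemma is_idealI:
  assumes "0 \<in> I" and "\<And>f g. f \<in> I \<Longrightarrow> g \<in> I \<Longrightarrow> f + g \<in> I" and "\<And>c f. f \<in> I \<Longrightarrow> c * f \<in> I"
  shows "is_ideal I"
  unfolding module.subspace_def[OF module_times] by (intro conjI ballI allI) (fact assms)+

lemma is_ideal_mult: "is_ideal I \<Longrightarrow> f \<in> I \<Longrightarrow> c * f \<in> I"
  by (rule module.subspace_scale[OF module_times])

lemma is_ideal_supported_in:
  assumes "up_closed U"
  shows "is_ideal (supported_in U :: ('n::finite, 'k::field) mpoly set)"
proof (rule is_idealI)
  show "(0 :: ('n, 'k) mpoly) \<in> supported_in U" by (simp add: supported_in_def)
next
  fix f g :: "('n, 'k) mpoly"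
  assume "f \<in> supported_in U" "g \<in> supported_in U"
  then show "f + g \<in> supported_in U"
    using Poly_Mapping.keys_add[of f g] by (auto simp: supported_in_def)
next
  fix c f :: "('n, 'k) mpoly"
  assume f: "f \<in> supported_in U"
  have "a + b \<in> U" if "b \<in> Poly_Mapping.keys f" for a b
  proof (rule up_closedD[OF assms])
    show "b \<in> U" using that f unfolding supported_in_def by blast
    show "b \<le> a + b" by (simp add: less_eq_vec_def)
  qed
  then have "{a + b | a b. a \<in> Poly_Mapping.keys c \<and> b \<in> Poly_Mapping.keys f} \<subseteq> U" by auto
  then show "c * f \<in> supported_in U"
    using keys_mult[of c f] by (simp add: supported_in_def)
qed

lemma poly_mapping_sum_single:
  "f = (\<Sum>a\<in>Poly_Mapping.keys f. Poly_Mapping.single a (Poly_Mapping.lookup f a))"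
  by (rule poly_mapping_eqI)
    (simp add: lookup_sum lookup_single when_def sum.delta in_keys_iff)

text \<open>
  The polynomials supported in the multiples of the generators form an ideal; conversely, each
  term of such a polynomial is a multiple of a generator.
\<close>

lemma ideal_gen_monomials:
  "(ideal_gen (xpow ` A) :: ('n::finite, 'k::field) mpoly set)
    = supported_in {a. \<exists>b\<in>A. b \<le> a}"  (is "?L = supported_in ?U")
proof
  show "?L \<subseteq> supported_in ?U"
    by (intro module.span_minimal[OF module_times] is_ideal_supported_in up_closed_generated) auto
next
  show "supported_in ?U \<subseteq> ?L"
  proof
    fix f :: "('n, 'k) mpoly" assume f: "f \<in> supported_in ?U"
    have "Poly_Mapping.single a (Poly_Mapping.lookup f a) \<in> ?L"
      if "a \<in> Poly_Mapping.keys f" for a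
    proof -
      have "a \<in> ?U" using that f unfolding supported_in_def by blast
      then obtain b where b: "b \<in> A" "b \<le> a" by blast
      have "(a - b) + b = a" using b(2) by (simp add: vec_eq_iff less_eq_vec_def)
      then have "Poly_Mapping.single a (Poly_Mapping.lookup f a)
          = Poly_Mapping.single (a - b) (Poly_Mapping.lookup f a) * (xpow b :: ('n, 'k) mpoly)"
        by (simp add: xpow_def mult_single)
      moreover have "xpow b \<in> ?L"
        using b(1) by (intro module.span_base[OF module_times]) simp
      ultimately show ?thesis
        by (simp add: module.span_scale[OF module_times])
    qed
    then have "(\<Sum>a\<in>Poly_Mapping.keys f. Poly_Mapping.single a (Poly_Mapping.lookup f a)) \<in> ?L"
      by (rule module.span_sum[OF module_times])
    then show "f \<in> ?L" by (simp only: poly_mapping_sum_single[symmetric])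
  qed
qed

lemma monomial_ideal_iff:
  "monomial_ideal (I :: ('n::finite, 'k::field) mpoly set)
    \<longleftrightarrow> (\<exists>U. up_closed U \<and> I = supported_in U)"
proof
  assume "monomial_ideal I"
  then obtain A where "I = ideal_gen (xpow ` A)" by (auto simp: monomial_ideal_def)
  then have "I = supported_in {a. \<exists>b\<in>A. b \<le> a}" by (simp add: ideal_gen_monomials)
  then show "\<exists>U. up_closed U \<and> I = supported_in U" using up_closed_generated by blast
next
  assume "\<exists>U. up_closed U \<and> I = supported_in U"
  then obtain U where U: "up_closed U" "I = supported_in U" by blast
  have "{a. \<exists>b\<in>U. b \<le> a} = U" using U(1) unfolding up_closed_def by blast
  then have "I = ideal_gen (xpow ` U)" using U(2) by (simp only: ideal_gen_monomials)
  then show "monomial_ideal I" unfolding monomial_ideal_def by blast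
qed


section \<open>Uniqueness of irredundant irreducible decompositions\<close>

lemma monomial_ideal_Inter:
  assumes "finite D" and "\<forall>J\<in>D. monomial_ideal (J :: ('n::finite, 'k::field) mpoly set)"
  shows "monomial_ideal (\<Inter>D)"
  using assms
proof (induction D rule: finite_induct)
  case empty
  show ?case unfolding monomial_ideal_iff
    by (rule exI[of _ UNIV]) (simp add: up_closed_def supported_in_def)
next
  case (insert J D)
  then obtain U V where "up_closed U" "J = supported_in U" "up_closed V" "\<Inter>D = supported_in V"
    by (auto simp: monomial_ideal_iff)
  then show ?case unfolding monomial_ideal_iff
    by (intro exI[of _ "U \<inter> V"]) (auto simp: supported_in_Int up_closed_def)
qed

text \<open>
  Distributivity of the lattice of monomial ideals: if \<open>J \<inter> K \<subseteq> Q\<close>, then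
  \<open>Q = (Q + J) \<inter> (Q + K)\<close>, and irreducibility of \<open>Q\<close> makes one of the two sums equal to \<open>Q\<close>.
\<close>

lemma irreducible_contains_factor:
  fixes Q J K :: "('n::finite, 'k::field) mpoly set"
  assumes Q: "monomial_ideal Q" "irreducible_ideal Q"
    and J: "monomial_ideal J" and K: "monomial_ideal K" and sub: "J \<inter> K \<subseteq> Q"
  shows "J \<subseteq> Q \<or> K \<subseteq> Q"
proof -
  obtain U V W where U: "up_closed U" "Q = supported_in U" and V: "up_closed V" "J = supported_in V"
    and W: "up_closed W" "K = supported_in W"
    using Q(1) J K by (auto simp: monomial_ideal_iff)
  have "V \<inter> W \<subseteq> U"
    using sub by (simp add: U V W supported_in_Int supported_in_subset_iff)
  then have "U = (U \<union> V) \<inter> (U \<union> W)" by blast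
  then have "Q = supported_in (U \<union> V) \<inter> supported_in (U \<union> W)"
    using U(2) by (simp add: supported_in_Int)
  moreover have "is_ideal (supported_in (U \<union> V) :: ('n, 'k) mpoly set)"
    "is_ideal (supported_in (U \<union> W) :: ('n, 'k) mpoly set)"
    using U V W by (auto intro!: is_ideal_supported_in simp: up_closed_def)
  ultimately have "Q = supported_in (U \<union> V) \<or> Q = supported_in (U \<union> W)"
    using Q(2) unfolding irreducible_ideal_def by blast
  then show ?thesis
    by (auto simp: U V W supported_in_eq_iff supported_in_subset_iff)
qed

lemma irreducible_contains_component:
  fixes Q :: "('n::finite, 'k::field) mpoly set"
  assumes Q: "monomial_ideal Q" "irreducible_ideal Q"
    and "finite D" and "\<forall>J\<in>D. monomial_ideal J" and "\<Inter>D \<subseteq> Q"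
  shows "\<exists>J\<in>D. J \<subseteq> Q"
  using assms(3-5)
proof (induction D rule: finite_induct)
  case empty
  then show ?case using Q(2) by (auto simp: irreducible_ideal_def)
next
  case (insert J D)
  then have "J \<subseteq> Q \<or> \<Inter>D \<subseteq> Q"
    by (intro irreducible_contains_factor[OF Q]) (auto intro: monomial_ideal_Inter)
  then show ?case using insert by auto
qed

lemma irredundant_no_inclusion:
  assumes "irredundant_irr_decomp I D" "P \<in> D" "Q \<in> D" "P \<subseteq> Q"
  shows "P = Q"
proof (rule ccontr)
  assume "P \<noteq> Q"
  then have "\<Inter>(D - {Q}) = \<Inter>D" using assms(2-4) by blast
  then show False using assms(1,3) by (auto simp: irredundant_irr_decomp_def)
qed

text \<open>
  A component \<open>Q\<close> of \<open>D\<close> contains a component \<open>P\<close> of \<open>E\<close>, which in turn contains a component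
  \<open>R\<close> of \<open>D\<close>. Irredundancy of \<open>D\<close> forces \<open>R = Q\<close>, and so \<open>P = Q\<close>.
\<close>

lemma irredundant_irr_decomp_subset:
  assumes D: "irredundant_irr_decomp I D" and E: "irredundant_irr_decomp I E"
  shows "D \<subseteq> E"
proof
  fix Q assume Q: "Q \<in> D"
  have comp: "\<exists>J\<in>C. J \<subseteq> P"
    if "irredundant_irr_decomp I B" "irredundant_irr_decomp I C" "P \<in> B" for B C P
    using that by (intro irreducible_contains_component) (auto simp: irredundant_irr_decomp_def)
  obtain P where P: "P \<in> E" "P \<subseteq> Q" using comp[OF D E Q] by blast
  obtain R where R: "R \<in> D" "R \<subseteq> P" using comp[OF E D P(1)] by blast
  have "R = Q" using irredundant_no_inclusion[OF D R(1) Q] P R by blast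
  then show "Q \<in> E" using P R by auto
qed

lemma Irr_eqI:
  assumes "irredundant_irr_decomp I D"
  shows "Irr I = D"
  unfolding Irr_def
  by (rule the_equality) (use assms irredundant_irr_decomp_subset in blast)+


section \<open>Ideals generated by powers of variables\<close>

definition vec_support :: "nat ^ 'n \<Rightarrow> 'n set"
  where "vec_support a = {i. a $ i \<noteq> 0}"

lemma char_vec_le_iff: "char_vec F \<le> a \<longleftrightarrow> F \<subseteq> vec_support a"
  by (auto simp: char_vec_def less_eq_vec_def vec_support_def Suc_le_eq)

lemma vec_support_char_vec [simp]: "vec_support (char_vec F) = F"
  by (auto simp: char_vec_def vec_support_def)

lemma vec_support_mono: "a \<le> b \<Longrightarrow> vec_support a \<subseteq> vec_support b"
  by (auto simp: vec_support_def less_eq_vec_def intro: less_le_trans)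

lemma axis_le_iff: "axis i m \<le> a \<longleftrightarrow> m \<le> (a $ i :: nat)"
  by (auto simp: axis_def less_eq_vec_def)

lemma mpower_ideal_eq_ideal_gen:
  "(mpower_ideal b :: ('n::finite, 'k::field) mpoly set)
    = ideal_gen (xpow ` {axis i (b $ i) | i. b $ i \<ge> 1})"
proof -
  have "{xpow (axis i (b $ i)) :: ('n, 'k) mpoly | i. b $ i \<ge> 1} = xpow ` {axis i (b $ i) | i. b $ i \<ge> 1}"
    by blast
  then show ?thesis by (simp only: mpower_ideal_def)
qed

lemma mpower_ideal_eq_supported_in:
  "(mpower_ideal b :: ('n::finite, 'k::field) mpoly set)
    = supported_in {a. \<exists>i. b $ i \<ge> 1 \<and> b $ i \<le> a $ i}"
proof -
  have "{a. \<exists>c\<in>{axis i (b $ i) | i. b $ i \<ge> 1}. c \<le> a} = {a. \<exists>i. b $ i \<ge> 1 \<and> b $ i \<le> a $ i}"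
    using axis_le_iff by blast
  then show ?thesis by (simp only: mpower_ideal_eq_ideal_gen ideal_gen_monomials)
qed

lemma monomial_ideal_mpower_ideal: "monomial_ideal (mpower_ideal b)"
  unfolding monomial_ideal_def mpower_ideal_eq_ideal_gen by blast

text \<open>
  The dual ideal is generated from all \<open>b\<close> whose ideal is a component, so each component must
  determine its exponent vector. It does: \<open>b $ i\<close> is the least positive exponent of a pure power
  of the \<open>i\<close>-th variable in the ideal, and is 0 if there is none.
\<close>

lemma mpower_ideal_inj:
  assumes "(mpower_ideal b :: ('n::finite, 'k::field) mpoly set) = mpower_ideal c"
  shows "b = c"
proof -
  let ?U = "\<lambda>b::nat^'n. {a::nat^'n. \<exists>i. b $ i \<ge> 1 \<and> b $ i \<le> a $ i}"
  have eq: "?U b = ?U c"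
    using assms by (simp only: mpower_ideal_eq_supported_in supported_in_eq_iff)
  have le: "b2 $ i \<ge> 1 \<and> b2 $ i \<le> b1 $ i"
    if U: "?U b1 = ?U b2" and "b1 $ i \<ge> 1" for b1 b2 :: "nat^'n" and i
  proof -
    have "axis i (b1 $ i) \<in> ?U b1" using that(2) by (auto intro!: exI[of _ i] simp: axis_def)
    then have "axis i (b1 $ i) \<in> ?U b2" by (simp only: U)
    then obtain j where j: "b2 $ j \<ge> 1" "b2 $ j \<le> axis i (b1 $ i) $ j" by blast
    then have "j = i" by (auto simp: axis_def split: if_splits)
    with j show ?thesis by (simp add: axis_def)
  qed
  have "b $ i = c $ i" for i
    using le[OF eq, of i] le[OF eq[symmetric], of i] by (cases "b $ i"; cases "c $ i") auto
  then show ?thesis by (simp add: vec_eq_iff)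
qed

lemma squarefree_mpower_ideal:
  "(mpower_ideal (char_vec (- F)) :: ('n::finite, 'k::field) mpoly set)
    = supported_in {a. \<not> vec_support a \<subseteq> F}"
proof -
  have "{a::nat^'n. \<exists>i. char_vec (- F) $ i \<ge> 1 \<and> char_vec (- F) $ i \<le> a $ i}
      = {a. \<not> vec_support a \<subseteq> F}"
    by (auto simp: char_vec_def vec_support_def Suc_le_eq)
  then show ?thesis by (simp only: mpower_ideal_eq_supported_in)
qed

text \<open>
  Finite nonempty sets of exponent vectors have a sum that arises in only one way, as the sum of
  their lexicographic maxima. No order on the coordinates has to be chosen if the two sets are
  restricted to the vectors of maximal \<open>i\<close>-th coordinate, for one coordinate \<open>i\<close> after the other.
\<close>

lemma unique_sum_on_coordinates:
  fixes X Y :: "(nat ^ 'n) set"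
  assumes "finite S" "finite X" "X \<noteq> {}" "finite Y" "Y \<noteq> {}"
  shows "\<exists>a\<in>X. \<exists>c\<in>Y. \<forall>a'\<in>X. \<forall>c'\<in>Y. (\<forall>i\<in>S. a' $ i + c' $ i = a $ i + c $ i)
    \<longrightarrow> (\<forall>i\<in>S. a' $ i = a $ i \<and> c' $ i = c $ i)"
  using assms
proof (induction S arbitrary: X Y rule: finite_induct)
  case empty
  then show ?case by auto
next
  case (insert i S)
  define p where "p = Max ((\<lambda>a. a $ i) ` X)"
  define q where "q = Max ((\<lambda>c. c $ i) ` Y)"
  define X' where "X' = {a\<in>X. a $ i = p}"
  define Y' where "Y' = {c\<in>Y. c $ i = q}"
  have "p \<in> (\<lambda>a. a $ i) ` X" "q \<in> (\<lambda>c. c $ i) ` Y"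
    unfolding p_def q_def using insert.prems by (auto intro!: Max_in)
  then have ne: "X' \<noteq> {}" "Y' \<noteq> {}" by (auto simp: X'_def Y'_def)
  have maxX: "a $ i \<le> p" if "a \<in> X" for a
    unfolding p_def using insert.prems that by (intro Max_ge) auto
  have maxY: "c $ i \<le> q" if "c \<in> Y" for c
    unfolding q_def using insert.prems that by (intro Max_ge) auto
  have "finite X'" "finite Y'" using insert.prems by (auto simp: X'_def Y'_def)
  then obtain a c where ac: "a \<in> X'" "c \<in> Y'"
    and uniq: "\<And>a' c'. a' \<in> X' \<Longrightarrow> c' \<in> Y' \<Longrightarrow> \<forall>j\<in>S. a' $ j + c' $ j = a $ j + c $ j
      \<Longrightarrow> \<forall>j\<in>S. a' $ j = a $ j \<and> c' $ j = c $ j"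
    using insert.IH[of X' Y'] ne by blast
  show ?case
  proof (rule bexI[of _ a], rule bexI[of _ c], intro ballI impI)
    fix a' c' j
    assume a': "a' \<in> X" and c': "c' \<in> Y"
      and sum: "\<forall>j\<in>insert i S. a' $ j + c' $ j = a $ j + c $ j" and j: "j \<in> insert i S"
    have "a' $ i + c' $ i = p + q" using sum ac by (auto simp: X'_def Y'_def)
    then have eq: "a' $ i = p" "c' $ i = q" using maxX[OF a'] maxY[OF c'] by auto
    then have "a' \<in> X'" "c' \<in> Y'" using a' c' by (auto simp: X'_def Y'_def)
    then have "\<forall>j\<in>S. a' $ j = a $ j \<and> c' $ j = c $ j" using uniq sum by blast
    then show "a' $ j = a $ j \<and> c' $ j = c $ j"
      using j eq ac by (auto simp: X'_def Y'_def)
  qed (use ac in \<open>auto simp: X'_def Y'_def\<close>)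
qed

lemma unique_sum:
  fixes X Y :: "(nat ^ 'n::finite) set"
  assumes "finite X" "X \<noteq> {}" "finite Y" "Y \<noteq> {}"
  shows "\<exists>a\<in>X. \<exists>c\<in>Y. \<forall>a'\<in>X. \<forall>c'\<in>Y. a' + c' = a + c \<longrightarrow> a' = a \<and> c' = c"
  using unique_sum_on_coordinates[OF finite[of UNIV] assms] by (simp add: vec_eq_iff all_conj_distrib)

text \<open>
  A coefficient of a product does not suffer cancellation at an exponent that splits in only one
  way; this takes over the role of leading terms.
\<close>

lemma lookup_mult_unique_sum:
  fixes f g :: "'a::cancel_comm_monoid_add \<Rightarrow>\<^sub>0 'b::semiring_0"
  assumes uniq: "\<And>a' c'. a' \<in> Poly_Mapping.keys f \<Longrightarrow> c' \<in> Poly_Mapping.keys g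
    \<Longrightarrow> a' + c' = a + c \<Longrightarrow> a' = a"
  shows "Poly_Mapping.lookup (f * g) (a + c) = Poly_Mapping.lookup f a * Poly_Mapping.lookup g c"
proof -
  have "Poly_Mapping.lookup f l * Sum_any (\<lambda>q. Poly_Mapping.lookup g q when a + c = l + q)
      = (Poly_Mapping.lookup f a * Poly_Mapping.lookup g c when l = a)" for l
  proof (cases "l = a")
    case True
    have "(Poly_Mapping.lookup g q when a + c = a + q) = (Poly_Mapping.lookup g q when q = c)" for q
      by (auto simp: when_def)
    then show ?thesis using True by simp
  next
    case False
    have "Poly_Mapping.lookup f l = 0 \<or> (\<forall>q. (Poly_Mapping.lookup g q when a + c = l + q) = 0)"
      using uniq[of l] False by (metis in_keys_iff when_def)
    then show ?thesis using False by auto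
  qed
  then show ?thesis by (simp add: lookup_mult)
qed

text \<open>
  The quotient by \<open>\<langle>x\<^sub>i | i \<notin> F\<rangle>\<close> is the polynomial ring in the variables of \<open>F\<close>, which is a
  domain: the terms of \<open>f\<close> and \<open>g\<close> in these variables contain two whose product
  does not cancel in \<open>f * g\<close>.
\<close>

lemma squarefree_mpower_ideal_prime:
  fixes f g :: "('n::finite, 'k::field) mpoly"
  assumes "f \<notin> mpower_ideal (char_vec (- F))" "g \<notin> mpower_ideal (char_vec (- F))"
  shows "f * g \<notin> mpower_ideal (char_vec (- F))"
proof -
  let ?X = "{a \<in> Poly_Mapping.keys f. vec_support a \<subseteq> F}"
  let ?Y = "{c \<in> Poly_Mapping.keys g. vec_support c \<subseteq> F}"
  have fin: "finite ?X" "finite ?Y" by simp_all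
  have ne: "?X \<noteq> {}" "?Y \<noteq> {}"
    using assms by (auto simp: squarefree_mpower_ideal supported_in_def)
  obtain a c where a: "a \<in> ?X" and c: "c \<in> ?Y"
    and uniq: "\<forall>a'\<in>?X. \<forall>c'\<in>?Y. a' + c' = a + c \<longrightarrow> a' = a \<and> c' = c"
    using unique_sum[OF fin(1) ne(1) fin(2) ne(2)] by (elim bexE)
  have supp_add: "vec_support (u + v) = vec_support u \<union> vec_support v" for u v :: "nat^'n"
    by (auto simp: vec_support_def)
  have ac: "vec_support (a + c) \<subseteq> F" using a c by (auto simp: supp_add)
  have "a' = a" if k: "a' \<in> Poly_Mapping.keys f" "c' \<in> Poly_Mapping.keys g"
    and eq: "a' + c' = a + c" for a' c'
  proof -
    have "vec_support (a' + c') \<subseteq> F" using ac eq by simp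
    then have "a' \<in> ?X" "c' \<in> ?Y" using k by (auto simp: supp_add)
    then show ?thesis using uniq eq by simp
  qed
  then have "Poly_Mapping.lookup (f * g) (a + c)
      = Poly_Mapping.lookup f a * Poly_Mapping.lookup g c"
    by (rule lookup_mult_unique_sum)
  then have "a + c \<in> Poly_Mapping.keys (f * g)" using a c by (simp add: in_keys_iff)
  then show ?thesis using ac by (auto simp: squarefree_mpower_ideal supported_in_def)
qed

lemma irreducible_squarefree_mpower_ideal:
  "irreducible_ideal (mpower_ideal (char_vec (- F)) :: ('n::finite, 'k::field) mpoly set)"
proof -
  let ?Q = "mpower_ideal (char_vec (- F)) :: ('n, 'k) mpoly set"
  have "is_ideal ?Q"
    by (simp add: mpower_ideal_def module.subspace_span[OF module_times])
  moreover have "(xpow 0 :: ('n, 'k) mpoly) \<notin> ?Q"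
    by (simp add: squarefree_mpower_ideal vec_support_def)
  moreover have "?Q = J \<or> ?Q = K" if JK: "is_ideal J" "is_ideal K" "?Q = J \<inter> K" for J K
  proof (rule ccontr)
    assume "\<not> ?thesis"
    then obtain f g where f: "f \<in> J" "f \<notin> ?Q" and g: "g \<in> K" "g \<notin> ?Q"
      using JK(3) by blast
    have "f * g \<in> J" using is_ideal_mult[OF JK(1) f(1), of g] by (simp add: mult.commute)
    moreover have "f * g \<in> K" using is_ideal_mult[OF JK(2) g(1)] .
    ultimately show False
      using squarefree_mpower_ideal_prime[OF f(2) g(2)] JK(3) by blast
  qed
  ultimately show ?thesis unfolding irreducible_ideal_def by blast
qed


section \<open>Stanley-Reisner ideals and their duals\<close>

definition facets :: "'a set set \<Rightarrow> 'a set set"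
  where "facets \<Gamma> = {F \<in> \<Gamma>. \<forall>G\<in>\<Gamma>. F \<subseteq> G \<longrightarrow> G = F}"

lemma face_in_facet:
  fixes \<Gamma> :: "'n::finite set set"
  assumes "F \<in> \<Gamma>"
  obtains G where "G \<in> facets \<Gamma>" "F \<subseteq> G"
proof -
  obtain G where "G \<in> \<Gamma>" "F \<subseteq> G" "\<forall>H\<in>\<Gamma>. G \<subseteq> H \<longrightarrow> G = H"
    using finite_has_maximal2[OF finite[of \<Gamma>] assms] by blast
  then show ?thesis using that[of G] by (auto simp: facets_def)
qed

lemma stanley_reisner_ideal_eq_supported_in:
  "(stanley_reisner_ideal \<Gamma> :: ('n::finite, 'k::field) mpoly set)
    = supported_in {a. \<exists>F. F \<notin> \<Gamma> \<and> F \<subseteq> vec_support a}"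
proof -
  have "{xpow (char_vec F) :: ('n, 'k) mpoly | F. F \<notin> \<Gamma>} = xpow ` {char_vec F | F. F \<notin> \<Gamma>}" by blast
  then have "stanley_reisner_ideal \<Gamma>
      = (supported_in {a. \<exists>b\<in>{char_vec F | F. F \<notin> \<Gamma>}. b \<le> a} :: ('n, 'k) mpoly set)"
    by (simp only: stanley_reisner_ideal_def ideal_gen_monomials)
  also have "{a. \<exists>b\<in>{char_vec F | F. F \<notin> \<Gamma>}. b \<le> a} = {a. \<exists>F. F \<notin> \<Gamma> \<and> F \<subseteq> vec_support a}"
    using char_vec_le_iff by blast
  finally show ?thesis .
qed

lemma stanley_reisner_ideal_complex:
  assumes "simplicial_cplx \<Gamma>"
  shows "(stanley_reisner_ideal \<Gamma> :: ('n::finite, 'k::field) mpoly set)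
    = supported_in {a. vec_support a \<notin> \<Gamma>}"
proof -
  have "{a. \<exists>F. F \<notin> \<Gamma> \<and> F \<subseteq> vec_support a} = {a. vec_support a \<notin> \<Gamma>}"
    using assms unfolding simplicial_cplx_def by blast
  then show ?thesis by (simp only: stanley_reisner_ideal_eq_supported_in)
qed

lemma Inter_facet_ideals:
  assumes "simplicial_cplx \<Gamma>"
  shows "(\<Inter>F\<in>facets \<Gamma>. mpower_ideal (char_vec (- F)))
    = (stanley_reisner_ideal \<Gamma> :: ('n::finite, 'k::field) mpoly set)"
proof -
  have "vec_support a \<notin> \<Gamma> \<longleftrightarrow> (\<forall>F\<in>facets \<Gamma>. \<not> vec_support a \<subseteq> F)" for a :: "nat^'n"
  proof
    show "vec_support a \<notin> \<Gamma> \<Longrightarrow> \<forall>F\<in>facets \<Gamma>. \<not> vec_support a \<subseteq> F"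
      using assms by (auto simp: facets_def simplicial_cplx_def)
    show "\<forall>F\<in>facets \<Gamma>. \<not> vec_support a \<subseteq> F \<Longrightarrow> vec_support a \<notin> \<Gamma>"
      by (meson face_in_facet)
  qed
  then have "{a::nat^'n. vec_support a \<notin> \<Gamma>} = (\<Inter>F\<in>facets \<Gamma>. {a. \<not> vec_support a \<subseteq> F})"
    by auto
  then show ?thesis
    by (auto simp: stanley_reisner_ideal_complex[OF assms] squarefree_mpower_ideal supported_in_def)
qed

text \<open>
  The monomial of a facet \<open>F\<close> witnesses irredundancy: it lies in the component of every other
  facet, but not in that of \<open>F\<close>.
\<close>

lemma Irr_stanley_reisner_ideal:
  assumes "simplicial_cplx \<Gamma>"
  shows "Irr (stanley_reisner_ideal \<Gamma> :: ('n::finite, 'k::field) mpoly set)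
    = (\<lambda>F. mpower_ideal (char_vec (- F))) ` facets \<Gamma>"  (is "Irr ?I = ?P ` _")
proof (rule Irr_eqI, unfold irredundant_irr_decomp_def, intro conjI ballI)
  show "finite (?P ` facets \<Gamma>)" by simp
  show "\<Inter>(?P ` facets \<Gamma>) = ?I" by (rule Inter_facet_ideals[OF assms])
next
  fix Q assume "Q \<in> ?P ` facets \<Gamma>"
  then obtain F where F: "F \<in> facets \<Gamma>" "Q = ?P F" by blast
  show "monomial_ideal Q" by (simp add: F monomial_ideal_mpower_ideal)
  show "irreducible_ideal Q" by (simp add: F irreducible_squarefree_mpower_ideal)
  show "\<Inter>(?P ` facets \<Gamma> - {Q}) \<noteq> ?I"
  proof
    assume eq: "\<Inter>(?P ` facets \<Gamma> - {Q}) = ?I"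
    have "xpow (char_vec F) \<in> ?P G" if "G \<in> facets \<Gamma>" "?P G \<noteq> Q" for G
      using that F by (auto simp: squarefree_mpower_ideal facets_def)
    then have "xpow (char_vec F) \<in> ?I" unfolding eq[symmetric] by blast
    then show False using F by (simp add: stanley_reisner_ideal_complex[OF assms] facets_def)
  qed
qed

text \<open>
  Membership in the ideal depends on the support only, so the characteristic vector of the support
  of \<open>a\<close> is an exponent below \<open>a\<close> in the ideal, and minimality makes it equal to \<open>a\<close>.
\<close>

lemma min_gen_exps_stanley_reisner_le_1:
  assumes "simplicial_cplx \<Gamma>"
    and "a \<in> min_gen_exps (stanley_reisner_ideal \<Gamma> :: ('n::finite, 'k::field) mpoly set)"
  shows "a $ i \<le> 1"
proof -
  have nonface: "vec_support a \<notin> \<Gamma>"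
    and min: "\<And>b. vec_support b \<notin> \<Gamma> \<Longrightarrow> b \<le> a \<Longrightarrow> b = a"
    using assms(2) by (auto simp: min_gen_exps_def stanley_reisner_ideal_complex[OF assms(1)])
  have "char_vec (vec_support a) = a"
    by (rule min) (use nonface in \<open>auto simp: char_vec_le_iff\<close>)
  then have "a $ i = char_vec (vec_support a) $ i" by simp
  then show ?thesis by (simp add: char_vec_def)
qed

lemma minimal_nonface_in_min_gen_exps:
  assumes "simplicial_cplx \<Gamma>" and G: "G \<notin> \<Gamma>" "\<And>H. H \<subset> G \<Longrightarrow> H \<in> \<Gamma>"
  shows "char_vec G \<in> min_gen_exps (stanley_reisner_ideal \<Gamma> :: ('n::finite, 'k::field) mpoly set)"
proof -
  have "b = char_vec G" if b: "vec_support b \<notin> \<Gamma>" "b \<le> char_vec G" for b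
  proof -
    have "vec_support b \<subseteq> G" using vec_support_mono[OF b(2)] by simp
    then have "vec_support b = G" using b(1) G(2) by blast
    then have "char_vec G \<le> b" by (simp add: char_vec_le_iff)
    then show ?thesis using b(2) by simp
  qed
  then show ?thesis
    using G(1) by (auto simp: min_gen_exps_def stanley_reisner_ideal_complex[OF assms(1)])
qed

text \<open>
  Adding \<open>i\<close> to the facet gives a nonface. A minimal nonface inside it is not contained in the
  facet, so it contains \<open>i\<close>, and its monomial is a minimal generator divisible by the \<open>i\<close>-th
  variable.
\<close>

lemma lcm_exp_outside_facet:
  assumes "simplicial_cplx \<Gamma>" and F: "F \<in> facets \<Gamma>" and i: "i \<notin> F"
  shows "lcm_exp (stanley_reisner_ideal \<Gamma> :: ('n::finite, 'k::field) mpoly set) $ i = 1"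
proof -
  let ?M = "min_gen_exps (stanley_reisner_ideal \<Gamma> :: ('n, 'k) mpoly set)"
  have "insert i F \<in> - \<Gamma>" using F i by (auto simp: facets_def)
  then obtain G where G: "G \<in> - \<Gamma>" "G \<subseteq> insert i F" and min: "\<forall>H\<in>-\<Gamma>. H \<subseteq> G \<longrightarrow> G = H"
    using finite_has_minimal2[OF finite[of "- \<Gamma>"]] by blast
  have "i \<in> G"
  proof (rule ccontr)
    assume "i \<notin> G"
    then have "G \<subseteq> F" using G(2) by blast
    then show False using F G(1) assms(1) by (auto simp: facets_def simplicial_cplx_def)
  qed
  have M: "char_vec G \<in> ?M"
    using G(1) min by (intro minimal_nonface_in_min_gen_exps[OF assms(1)]) auto
  have bound: "\<And>a. a \<in> ?M \<Longrightarrow> a $ i \<le> 1"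
    by (rule min_gen_exps_stanley_reisner_le_1[OF assms(1)])
  have "(SUP a\<in>?M. a $ i) \<le> 1"
    using M bound by (intro cSUP_least) auto
  moreover have "char_vec G $ i \<le> (SUP a\<in>?M. a $ i)"
    using M bound by (intro cSUP_upper bdd_aboveI2[where M=1]) auto
  ultimately show ?thesis using \<open>i \<in> G\<close> by (simp add: lcm_exp_def char_vec_def)
qed

text \<open>
  At \<open>i \<in> F\<close> both sides are 0. At \<open>i \<notin> F\<close> the left-hand side is \<open>1 + 1 - 1\<close>, because the lcm has
  exponent 1 there.
\<close>

lemma dual_exp_facet_complement:
  assumes "simplicial_cplx \<Gamma>" and "F \<in> facets \<Gamma>"
  shows "dual_exp (lcm_exp (stanley_reisner_ideal \<Gamma> :: ('n::finite, 'k::field) mpoly set))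
    (char_vec (- F)) = char_vec (- F)"
  using lcm_exp_outside_facet[OF assms, where 'k='k]
  by (auto simp: dual_exp_def vec_eq_iff char_vec_def)

text \<open>
  The nonfaces of the dual complex are the complements of the faces. The minimal ones among them
  are the complements of facets.
\<close>

lemma nonface_of_dual_cplx_iff:
  fixes \<Gamma> :: "'n::finite set set"
  shows "(\<exists>F. F \<notin> dual_cplx \<Gamma> \<and> F \<subseteq> A) \<longleftrightarrow> (\<exists>F\<in>facets \<Gamma>. - F \<subseteq> A)"
proof
  assume "\<exists>F. F \<notin> dual_cplx \<Gamma> \<and> F \<subseteq> A"
  then obtain F where F: "- F \<in> \<Gamma>" "F \<subseteq> A" by (auto simp: dual_cplx_def)
  obtain G where "G \<in> facets \<Gamma>" "- F \<subseteq> G" using face_in_facet[OF F(1)] .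
  then show "\<exists>F\<in>facets \<Gamma>. - F \<subseteq> A" using F(2) by blast
next
  assume "\<exists>F\<in>facets \<Gamma>. - F \<subseteq> A"
  then obtain F where "F \<in> \<Gamma>" "- F \<subseteq> A" by (auto simp: facets_def)
  then show "\<exists>F. F \<notin> dual_cplx \<Gamma> \<and> F \<subseteq> A"
    by (intro exI[of _ "- F"]) (simp add: dual_cplx_def)
qed

theorem proposition1p10:
  fixes \<Gamma> :: "'n::finite set set"
  assumes "CARD('n) \<ge> 2"
    and "simplicial_cplx \<Gamma>"
  shows "canonical_alexander_dual (stanley_reisner_ideal \<Gamma> :: ('n, 'k::field) mpoly set)
       = stanley_reisner_ideal (dual_cplx \<Gamma>)"
proof -
  let ?I = "stanley_reisner_ideal \<Gamma> :: ('n, 'k) mpoly set"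
  have "{b. mpower_ideal b \<in> Irr ?I} = (\<lambda>F. char_vec (- F)) ` facets \<Gamma>"
    unfolding Irr_stanley_reisner_ideal[OF assms(2)]
    using mpower_ideal_inj[where 'k='k] by blast
  then have dual_exps: "dual_exp (lcm_exp ?I) ` {b. mpower_ideal b \<in> Irr ?I}
      = (\<lambda>F. char_vec (- F)) ` facets \<Gamma>"
    by (simp add: image_image dual_exp_facet_complement[OF assms(2)] cong: image_cong)
  have "canonical_alexander_dual ?I
      = ideal_gen (xpow ` dual_exp (lcm_exp ?I) ` {b. mpower_ideal b \<in> Irr ?I})"
    by (simp only: canonical_alexander_dual_def alexander_dual_def setcompr_eq_image image_image)
  also have "\<dots> = supported_in {a. \<exists>F\<in>facets \<Gamma>. char_vec (- F) \<le> a}"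
    by (simp only: dual_exps ideal_gen_monomials bex_simps)
  also have "\<dots> = stanley_reisner_ideal (dual_cplx \<Gamma>)"
    by (simp only: stanley_reisner_ideal_eq_supported_in nonface_of_dual_cplx_iff char_vec_le_iff)
  finally show ?thesis .
qed

end
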